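(* Let $N\ge 1$ and let $x_1,\dots,x_N\in\mathbb{R}$ be center points. For all parameters $\varepsilon>0$, $\gamma>0$, $t\in(0,1)$ and all shifts $x_0\in\mathbb{R}$, the pointwise (in $x\in\mathbb{R}$) expansion $$\phi_k(x)=e^{-\varepsilon^2(x-x_k)^2}=\exp\left(\varepsilon^2\Delta_k^2\left(\frac{\varepsilon^2}{\gamma^2}-1\right)\right)\sum_{\ell\ge 0}\frac{\varepsilon^{2\ell}\sqrt{2^\ell}}{\gamma^\ell\sqrt{t^\ell\,\ell!}}\,\Delta_k^\ell\, H_\ell^{\gamma,\varepsilon,t}(x-x_0)$$ holds for all $k=1,\dots,N$, where $\Delta_k=x_k-x_0$. Moreover, the RBF interpolant $s(x)=\sum_{k=1}^N\alpha_k\phi_k(x)$ can be pointwise computed as $$s(x)=\sum_{k=1}^N\alpha_k\exp\left(\varepsilon^2\Delta_k^2\left(\frac{\varepsilon^2}{\gamma^2}-1\right)\right)\sum_{\ell\ge 0}\frac{\varepsilon^{2\ell}\sqrt{2^\ell}}{\gamma^\ell\sqrt{t^\ell\,\ell!}}\,\Delta_k^\ell\, H_\ell^{\gamma,\varepsilon,t}(x-x_0).$$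
   Context: The physicists' Hermite polynomials $\{h_\ell\}_{\ell\ge 0}$ are given by $h_{\ell+1}(x)=2x\,h_\ell(x)-2\ell\,h_{\ell-1}(x)$, $h_0(x)=1$, $h_{-1}(x)=0$. The HermiteGF functions are $$H_\ell^{\gamma,\varepsilon,t}(x)=\frac{t^{\ell/2}}{\sqrt{2^\ell\,\ell!}}\,h_\ell(\gamma x)\,e^{-\varepsilon^2x^2},\qquad \ell\ge 0,\ x\in\mathbb{R}.$$ The Gaussian radial basis functions are $\phi_k(x)=e^{-\varepsilon^2(x-x_k)^2}$. The RBF interpolant is a function of the form $s(x)=\sum_{k=1}^N\alpha_k\phi_k(x)$ with real coefficients $\alpha_1,\dots,\alpha_N$ satisfying the collocation conditions $s(x_i^{\mathrm{col}})=f_i$, $i=1,\dots,N$, for given collocation points $x_i^{\mathrm{col}}\in\mathbb{R}$ and values $f_i\in\mathbb{R}$. The convention $0^0=1$ is used for powers. *)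

theory Defs
  imports "HOL-Analysis.Analysis"
begin

text \<open>
  Physicists' Hermite polynomials, \<open>h\<^sub>l\<^sub>+\<^sub>1(x) = 2 x h\<^sub>l(x) - 2 l h\<^sub>l\<^sub>-\<^sub>1(x)\<close> with
  \<open>h\<^sub>0 = 1\<close> and \<open>h\<^sub>-\<^sub>1 = 0\<close>.  Since the index is a natural number, the instance \<open>l = 0\<close> of the
  recurrence, where the term in \<open>h\<^sub>-\<^sub>1\<close> vanishes, is a separate equation.
\<close>

fun hermite :: "nat \<Rightarrow> real \<Rightarrow> real" where
  "hermite 0 x = 1"
| "hermite (Suc 0) x = 2 * x * hermite 0 x"
| "hermite (Suc (Suc l)) x = 2 * x * hermite (Suc l) x - 2 * real (Suc l) * hermite l x"

definition hermiteGF :: "real \<Rightarrow> real \<Rightarrow> real \<Rightarrow> nat \<Rightarrow> real \<Rightarrow> real" where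
  "hermiteGF \<gamma> \<epsilon> t l x =
     t powr (real l / 2) / sqrt (2 ^ l * fact l) * hermite l (\<gamma> * x) * exp (- (\<epsilon>\<^sup>2 * x\<^sup>2))"

definition gaussian_rbf :: "real \<Rightarrow> real \<Rightarrow> real \<Rightarrow> real" where
  "gaussian_rbf \<epsilon> c x = exp (- (\<epsilon>\<^sup>2 * (x - c)\<^sup>2))"

text \<open>
  \<open>s\<close> is the interpolant with centers \<open>c 1, \<dots>, c N\<close> and coefficients \<open>\<alpha> 1, \<dots>, \<alpha> N\<close> for the
  values \<open>f i\<close> at the collocation points \<open>xcol i\<close>; values of these families outside
  \<open>{1..N}\<close> are irrelevant.
\<close>

definition is_rbf_interpolant ::
  "real \<Rightarrow> nat \<Rightarrow> (nat \<Rightarrow> real) \<Rightarrow> (nat \<Rightarrow> real) \<Rightarrow> (nat \<Rightarrow> real) \<Rightarrow> (nat \<Rightarrow> real) \<Rightarrow> (real \<Rightarrow> real) \<Rightarrow> bool"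
  where
  "is_rbf_interpolant \<epsilon> N c xcol f \<alpha> s \<longleftrightarrow>
     (\<forall>x. s x = (\<Sum>k=1..N. \<alpha> k * gaussian_rbf \<epsilon> (c k) x)) \<and>
     (\<forall>i\<in>{1..N}. s (xcol i) = f i)"

end

theory Submission
  imports Defs
begin

text \<open>
  In the \<open>l\<close>-th summand the powers of \<open>t\<close> and \<open>2\<close> in the normalisation of the HermiteGF
  function cancel those in the coefficient, and the two factors \<open>1 / sqrt l!\<close> combine to
  \<open>1 / l!\<close>.  With \<open>u = \<gamma> (x - x0)\<close> and \<open>w = \<epsilon>\<^sup>2 \<Delta> / \<gamma>\<close> the series is therefore
  \<open>exp (- \<epsilon>\<^sup>2 (x - x0)\<^sup>2)\<close> times the exponential generating function of the Hermite polynomials,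
  \<open>\<Sum>l. h\<^sub>l(u) w\<^sup>l / l! = exp (2 u w - w\<^sup>2)\<close>, and the expansion of the Gaussian follows by
  completing the square: the prefactor removes \<open>- w\<^sup>2\<close> and supplies the \<open>- \<epsilon>\<^sup>2 \<Delta>\<^sup>2\<close> of
  \<open>- \<epsilon>\<^sup>2 ((x - x0) - \<Delta>)\<^sup>2\<close>.  The formula for an interpolant is a finite linear combination of
  these expansions.

  The generating function itself comes from the three-term recurrence.  Read for the coefficients
  \<open>a\<^sub>l = h\<^sub>l(u) / l!\<close>, it is \<open>(l + 1) a\<^sub>l\<^sub>+\<^sub>1 = 2 u a\<^sub>l - 2 a\<^sub>l\<^sub>-\<^sub>1\<close>.  The growing factor
  on the left makes the power series converge everywhere (\<open>summable_hermite_egf\<close>), and, as an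
  identity between power series, it says that the sum \<open>G\<close> solves \<open>G' = (2 u - 2 w) G\<close>
  (\<open>hermite_egf_ode\<close>).  With \<open>G 0 = 1\<close> this linear equation determines \<open>G\<close>
  (\<open>hermite_egf_sums\<close>).
\<close>

definition hermite_coeff :: "real \<Rightarrow> nat \<Rightarrow> real" where
  "hermite_coeff u n = hermite n u / fact n"

lemma hermite_coeff_0 [simp]: "hermite_coeff u 0 = 1"
  and hermite_coeff_Suc_0 [simp]: "hermite_coeff u (Suc 0) = 2 * u"
  by (simp_all add: hermite_coeff_def)

lemma hermite_coeff_rec:
  "real (Suc (Suc n)) * hermite_coeff u (Suc (Suc n)) =
     2 * u * hermite_coeff u (Suc n) - 2 * hermite_coeff u n"
proof -
  have "fact (Suc (Suc n)) = real (Suc (Suc n)) * (real (Suc n) * fact n)"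
    "fact (Suc n) = real (Suc n) * fact n"
    by (simp_all only: fact_Suc of_nat_mult of_nat_fact)
  then show ?thesis
    unfolding hermite_coeff_def
    by (simp add: divide_simps del: of_nat_Suc fact_Suc)
qed

text \<open>
  In the recurrence for \<open>\<bar>a\<^sub>n\<bar> R\<^sup>n\<close> the two previous terms enter with total weight
  \<open>(2 \<bar>u\<bar> R + 2 R\<^sup>2) / n\<close>.  Once \<open>n\<close> exceeds the numerator the sequence cannot rise above
  its earlier maximum, whatever \<open>R\<close> is.
\<close>

lemma hermite_coeff_bounded:
  assumes "R \<ge> 0"
  obtains C where "\<And>n. \<bar>hermite_coeff u n\<bar> * R ^ n \<le> C"
proof -
  define b where "b n = \<bar>hermite_coeff u n\<bar> * R ^ n" for n
  define K where "K = 2 * \<bar>u\<bar> * R + 2 * R\<^sup>2"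
  obtain L :: nat where L: "K \<le> real L"
    using real_arch_simple by blast
  define C where "C = (\<Sum>i\<le>Suc L. b i)"
  have b_nonneg: "b n \<ge> 0" for n
    using assms by (simp add: b_def)
  have C_nonneg: "C \<ge> 0"
    by (simp add: C_def b_nonneg sum_nonneg)
  have b_rec: "real (Suc (Suc n)) * b (Suc (Suc n)) \<le> 2 * \<bar>u\<bar> * R * b (Suc n) + 2 * R\<^sup>2 * b n" for n
  proof -
    have "real (Suc (Suc n)) * b (Suc (Suc n))
        = \<bar>real (Suc (Suc n)) * hermite_coeff u (Suc (Suc n))\<bar> * R ^ Suc (Suc n)"
      by (simp add: b_def abs_mult)
    also have "\<dots> = \<bar>2 * u * hermite_coeff u (Suc n) - 2 * hermite_coeff u n\<bar> * R ^ Suc (Suc n)"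
      by (simp only: hermite_coeff_rec)
    also have "\<dots> \<le> (2 * \<bar>u\<bar> * \<bar>hermite_coeff u (Suc n)\<bar> + 2 * \<bar>hermite_coeff u n\<bar>) * R ^ Suc (Suc n)"
    proof (rule mult_right_mono)
      show "\<bar>2 * u * hermite_coeff u (Suc n) - 2 * hermite_coeff u n\<bar>
          \<le> 2 * \<bar>u\<bar> * \<bar>hermite_coeff u (Suc n)\<bar> + 2 * \<bar>hermite_coeff u n\<bar>"
        using abs_triangle_ineq4[of "2 * u * hermite_coeff u (Suc n)" "2 * hermite_coeff u n"]
        by (simp add: abs_mult)
    qed (use assms in simp)
    also have "\<dots> = 2 * \<bar>u\<bar> * R * b (Suc n) + 2 * R\<^sup>2 * b n"
      by (simp add: b_def power2_eq_square algebra_simps)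
    finally show ?thesis .
  qed
  have "b n \<le> C" for n
  proof (induction n rule: less_induct)
    case (less n)
    show ?case
    proof (cases "n \<le> Suc L")
      case True
      then show ?thesis
        unfolding C_def by (intro member_le_sum) (auto simp: b_nonneg)
    next
      case False
      then obtain m where m: "n = Suc (Suc m)"
        by (metis Suc_le_mono not0_implies_Suc le0)
      have "real n * b n \<le> 2 * \<bar>u\<bar> * R * b (Suc m) + 2 * R\<^sup>2 * b m"
        using b_rec m by simp
      also have "\<dots> \<le> 2 * \<bar>u\<bar> * R * C + 2 * R\<^sup>2 * C"
        using less.IH m assms by (intro add_mono mult_left_mono) auto
      also have "\<dots> = K * C"
        by (simp add: K_def algebra_simps)
      also have "\<dots> \<le> real n * C"
        using L False C_nonneg by (intro mult_right_mono) auto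
      finally show ?thesis
        using m by (simp del: of_nat_Suc)
    qed
  qed
  then show thesis
    unfolding b_def by (rule that)
qed

text \<open>
  Boundedness at the larger radius \<open>\<bar>w\<bar> + 1\<close> compares the series at \<open>w\<close> with a geometric one.
\<close>

lemma summable_hermite_egf: "summable (\<lambda>n. hermite_coeff u n * w ^ n)"
proof -
  obtain C where C: "\<And>n. \<bar>hermite_coeff u n\<bar> * (\<bar>w\<bar> + 1) ^ n \<le> C"
    using hermite_coeff_bounded[of "\<bar>w\<bar> + 1" u] by auto
  have "summable (\<lambda>n. norm (hermite_coeff u n) * \<bar>w\<bar> ^ n)"
    using C by (intro Abel_lemma[where r = "\<bar>w\<bar>" and r0 = "\<bar>w\<bar> + 1"]) auto
  then have "summable (\<lambda>n. norm (hermite_coeff u n * w ^ n))"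
    by (simp add: abs_mult power_abs)
  then show ?thesis
    by (rule summable_norm_cancel)
qed

text \<open>
  Termwise differentiation produces the coefficients \<open>(n + 1) a\<^sub>n\<^sub>+\<^sub>1\<close>; the recurrence turns them
  into those of \<open>2 u G\<close> minus those of \<open>2 w G\<close>, the factor \<open>w\<close> being the index shift.
\<close>

lemma hermite_egf_ode:
  defines "G \<equiv> \<lambda>u w. \<Sum>n. hermite_coeff u n * w ^ n"
  shows "(G u has_real_derivative (2 * u - 2 * w) * G u w) (at w)"
proof -
  let ?a = "hermite_coeff u"
  have G: "(\<lambda>n. ?a n * w ^ n) sums G u w"
    unfolding G_def by (rule summable_sums[OF summable_hermite_egf])
  have "(\<lambda>n. (case n of 0 \<Rightarrow> 0 | Suc m \<Rightarrow> ?a m) * w ^ n) sums (w * G u w)"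
    using sums_mult[OF G, of w]
      sums_Suc[where f = "\<lambda>n. (case n of 0 \<Rightarrow> 0 | Suc m \<Rightarrow> ?a m) * w ^ n" and l = "w * G u w"]
    by (simp add: mult_ac)
  then have "(\<lambda>n. 2 * u * (?a n * w ^ n) - 2 * ((case n of 0 \<Rightarrow> 0 | Suc m \<Rightarrow> ?a m) * w ^ n))
      sums (2 * u * G u w - 2 * (w * G u w))"
    by (intro sums_diff sums_mult G)
  moreover have "diffs ?a n * w ^ n =
      2 * u * (?a n * w ^ n) - 2 * ((case n of 0 \<Rightarrow> 0 | Suc m \<Rightarrow> ?a m) * w ^ n)" for n
  proof (cases n)
    case (Suc m)
    then have diffs: "diffs ?a n = 2 * u * ?a n - 2 * ?a m"
      by (simp only: diffs_def hermite_coeff_rec)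
    show ?thesis
      unfolding diffs by (simp add: Suc algebra_simps)
  qed (simp add: diffs_def)
  ultimately have "(\<lambda>n. diffs ?a n * w ^ n) sums (2 * u * G u w - 2 * (w * G u w))"
    by (simp only:)
  then have "(\<Sum>n. diffs ?a n * w ^ n) = (2 * u - 2 * w) * G u w"
    by (simp add: sums_iff algebra_simps)
  then show ?thesis
    using termdiffs_strong_converges_everywhere[of ?a w] summable_hermite_egf
    unfolding G_def by simp
qed

text \<open>
  The derivative of \<open>G(w) exp (w\<^sup>2 - 2 u w)\<close> vanishes, so this product keeps its value \<open>1\<close> at
  \<open>w = 0\<close>.
\<close>

theorem hermite_egf_sums: "(\<lambda>n. hermite n u / fact n * w ^ n) sums exp (2 * u * w - w\<^sup>2)"
proof -
  define G where "G w = (\<Sum>n. hermite_coeff u n * w ^ n)" for w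
  have "((\<lambda>w. G w * exp (w\<^sup>2 - 2 * u * w)) has_real_derivative 0) (at w)" for w
    by (rule derivative_eq_intros refl hermite_egf_ode[of u, folded G_def])+
      (simp add: algebra_simps)
  then have "G w * exp (w\<^sup>2 - 2 * u * w) = G 0 * exp (0\<^sup>2 - 2 * u * 0)"
    by (intro DERIV_isconst_all) auto
  moreover have "G 0 = 1"
    by (simp only: G_def powser_zero hermite_coeff_0)
  ultimately have "G w = exp (2 * u * w - w\<^sup>2)"
    by (simp add: exp_diff field_simps)
  then show ?thesis
    using summable_sums[OF summable_hermite_egf, of u w]
    by (simp add: G_def hermite_coeff_def)
qed

lemma hermiteGF_summand:
  assumes "t > 0"
  shows "\<epsilon> ^ (2 * l) * sqrt (2 ^ l) / (\<gamma> ^ l * sqrt (t ^ l * fact l)) * d ^ l * hermiteGF \<gamma> \<epsilon> t l y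
    = exp (- (\<epsilon>\<^sup>2 * y\<^sup>2)) * (hermite l (\<gamma> * y) / fact l * (\<epsilon>\<^sup>2 * d / \<gamma>) ^ l)"
proof -
  have t: "t powr (real l / 2) = sqrt (t ^ l)"
    using assms by (simp add: powr_half_sqrt_powr powr_realpow)
  have nz: "sqrt (2 ^ l) \<noteq> (0::real)" "sqrt (t ^ l) \<noteq> 0"
    using assms by auto
  have sq: "sqrt (fact l) * sqrt (fact l) = (fact l :: real)"
    by simp
  have "\<epsilon> ^ (2 * l) * sqrt (2 ^ l) / (\<gamma> ^ l * sqrt (t ^ l * fact l)) * d ^ l * hermiteGF \<gamma> \<epsilon> t l y
    = (sqrt (2 ^ l) / sqrt (2 ^ l)) * (sqrt (t ^ l) / sqrt (t ^ l)) * exp (- (\<epsilon>\<^sup>2 * y\<^sup>2)) *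
      (hermite l (\<gamma> * y) / (sqrt (fact l) * sqrt (fact l)) * (\<epsilon> ^ (2 * l) * d ^ l / \<gamma> ^ l))"
    unfolding hermiteGF_def t real_sqrt_mult
    by (simp only: times_divide_times_eq times_divide_eq_left times_divide_eq_right
        divide_divide_eq_left mult_ac)
  also have "\<dots> = exp (- (\<epsilon>\<^sup>2 * y\<^sup>2)) * (hermite l (\<gamma> * y) / fact l * (\<epsilon>\<^sup>2 * d / \<gamma>) ^ l)"
    unfolding sq using nz by (simp add: power_mult power_mult_distrib power_divide)
  finally show ?thesis .
qed

lemma gaussian_rbf_hermiteGF_expansion:
  fixes \<epsilon> \<gamma> t c x0 x :: real
  assumes "t > 0" and "\<gamma> \<noteq> 0"
  defines "S \<equiv> \<lambda>l. \<epsilon> ^ (2 * l) * sqrt (2 ^ l) / (\<gamma> ^ l * sqrt (t ^ l * fact l)) * (c - x0) ^ l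
                      * hermiteGF \<gamma> \<epsilon> t l (x - x0)"
  shows "summable S"
    and "gaussian_rbf \<epsilon> c x = exp (\<epsilon>\<^sup>2 * (c - x0)\<^sup>2 * (\<epsilon>\<^sup>2 / \<gamma>\<^sup>2 - 1)) * suminf S"
proof -
  define y d where "y = x - x0" and "d = c - x0"
  have S: "S sums (exp (- (\<epsilon>\<^sup>2 * y\<^sup>2)) * exp (2 * (\<gamma> * y) * (\<epsilon>\<^sup>2 * d / \<gamma>) - (\<epsilon>\<^sup>2 * d / \<gamma>)\<^sup>2))"
    unfolding S_def hermiteGF_summand[OF assms(1)] y_def[symmetric] d_def[symmetric]
    by (intro sums_mult hermite_egf_sums)
  then show "summable S"
    by (rule sums_summable)
  have "- (\<epsilon>\<^sup>2 * (y - d)\<^sup>2) = \<epsilon>\<^sup>2 * d\<^sup>2 * (\<epsilon>\<^sup>2 / \<gamma>\<^sup>2 - 1)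
      + (- (\<epsilon>\<^sup>2 * y\<^sup>2) + (2 * (\<gamma> * y) * (\<epsilon>\<^sup>2 * d / \<gamma>) - (\<epsilon>\<^sup>2 * d / \<gamma>)\<^sup>2))"
    using assms(2) by (simp add: field_simps power2_eq_square)
  moreover have "x - c = y - d"
    by (simp add: y_def d_def)
  ultimately show "gaussian_rbf \<epsilon> c x = exp (\<epsilon>\<^sup>2 * (c - x0)\<^sup>2 * (\<epsilon>\<^sup>2 / \<gamma>\<^sup>2 - 1)) * suminf S"
    unfolding sums_unique[OF S, symmetric] d_def[symmetric] gaussian_rbf_def
    by (simp only: exp_add)
qed

theorem proposition2p1:
  fixes N :: nat and c :: "nat \<Rightarrow> real" and \<epsilon> \<gamma> t x0 :: real and \<Delta> :: "nat \<Rightarrow> real"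
  assumes "N \<ge> 1" and "\<epsilon> > 0" and "\<gamma> > 0" and "t \<in> {0<..<1}"
    and "\<And>k. \<Delta> k = c k - x0"
  shows
    "(\<forall>k\<in>{1..N}. \<forall>x.
        summable (\<lambda>l. \<epsilon> ^ (2 * l) * sqrt (2 ^ l) / (\<gamma> ^ l * sqrt (t ^ l * fact l)) * \<Delta> k ^ l
                        * hermiteGF \<gamma> \<epsilon> t l (x - x0)) \<and>
        gaussian_rbf \<epsilon> (c k) x =
          exp (\<epsilon>\<^sup>2 * (\<Delta> k)\<^sup>2 * (\<epsilon>\<^sup>2 / \<gamma>\<^sup>2 - 1)) *
          (\<Sum>l. \<epsilon> ^ (2 * l) * sqrt (2 ^ l) / (\<gamma> ^ l * sqrt (t ^ l * fact l)) * \<Delta> k ^ l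
                 * hermiteGF \<gamma> \<epsilon> t l (x - x0))) \<and>
     (\<forall>xcol f \<alpha> s. is_rbf_interpolant \<epsilon> N c xcol f \<alpha> s \<longrightarrow>
        (\<forall>x. s x =
          (\<Sum>k=1..N. \<alpha> k * exp (\<epsilon>\<^sup>2 * (\<Delta> k)\<^sup>2 * (\<epsilon>\<^sup>2 / \<gamma>\<^sup>2 - 1)) *
            (\<Sum>l. \<epsilon> ^ (2 * l) * sqrt (2 ^ l) / (\<gamma> ^ l * sqrt (t ^ l * fact l)) * \<Delta> k ^ l
                   * hermiteGF \<gamma> \<epsilon> t l (x - x0)))))"
proof -
  have "t > 0" and "\<gamma> \<noteq> 0"
    using assms by auto
  note expansion = gaussian_rbf_hermiteGF_expansion[OF this]
  show ?thesis
    unfolding assms(5)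
  proof (intro conjI ballI allI impI)
    fix xcol f \<alpha> s x
    assume "is_rbf_interpolant \<epsilon> N c xcol f \<alpha> s"
    then have "s x = (\<Sum>k=1..N. \<alpha> k * gaussian_rbf \<epsilon> (c k) x)"
      by (simp add: is_rbf_interpolant_def)
    also have "\<dots> = (\<Sum>k=1..N. \<alpha> k * exp (\<epsilon>\<^sup>2 * ((c k - x0))\<^sup>2 * (\<epsilon>\<^sup>2 / \<gamma>\<^sup>2 - 1)) *
            (\<Sum>l. \<epsilon> ^ (2 * l) * sqrt (2 ^ l) / (\<gamma> ^ l * sqrt (t ^ l * fact l)) * (c k - x0) ^ l
                   * hermiteGF \<gamma> \<epsilon> t l (x - x0)))"
      by (intro sum.cong refl) (subst expansion(2)[where ?x0.0 = x0], rule mult.assoc[symmetric])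
    finally show "s x = \<dots>" .
  qed (rule expansion)+
qed

end
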